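(* Let $f:\mathbb{D}^2\to\mathbb{D}$ be a holomorphic function with $f(0,0)=0$. Then $f$ is everywhere infinitesimally extremal if and only if there exist $\mu,a,b\in\mathbb{C}$ with $|\mu|=1$ and $|a|+|b|=1$ such that $$f(z,w)=\mu\,\frac{az+bw-zw}{1-\bar{b}z-\bar{a}w}\qquad\text{for all }(z,w)\in\mathbb{D}^2.$$
   Context: $\mathbb{D}=\{\zeta\in\mathbb{C}:|\zeta|<1\}$ is the open unit disk and $\mathbb{D}^2=\mathbb{D}\times\mathbb{D}$ is the bidisk. A holomorphic function $f:\mathbb{D}^2\to\mathbb{D}$ is called everywhere infinitesimally extremal if $$(1-|z|^2)\left|\frac{\partial f}{\partial z}(z,w)\right|+(1-|w|^2)\left|\frac{\partial f}{\partial w}(z,w)\right|=1-|f(z,w)|^2$$ for every $(z,w)\in\mathbb{D}^2$. *)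

theory Defs
  imports "HOL-Complex_Analysis.Complex_Analysis"
begin

abbreviation unit_disk :: "complex set" ("\<D>") where
  "\<D> \<equiv> ball 0 1"

abbreviation bidisk :: "(complex \<times> complex) set" ("\<D>\<^sup>2") where
  "\<D>\<^sup>2 \<equiv> \<D> \<times> \<D>"

text \<open>Holomorphy in two complex variables: at every point of \<open>S\<close> there is a Frechet derivative,
  and it is complex-linear.\<close>

definition holomorphic2_on :: "(complex \<times> complex \<Rightarrow> complex) \<Rightarrow> (complex \<times> complex) set \<Rightarrow> bool"
    (infixl "holomorphic2'_on" 50) where
  "f holomorphic2_on S \<longleftrightarrow>
     (\<forall>p\<in>S. \<exists>A B. (f has_derivative (\<lambda>(h, k). A * h + B * k)) (at p within S))"

definition partial_z :: "(complex \<times> complex \<Rightarrow> complex) \<Rightarrow> complex \<times> complex \<Rightarrow> complex" where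
  "partial_z f = (\<lambda>(z, w). deriv (\<lambda>\<zeta>. f (\<zeta>, w)) z)"

definition partial_w :: "(complex \<times> complex \<Rightarrow> complex) \<Rightarrow> complex \<times> complex \<Rightarrow> complex" where
  "partial_w f = (\<lambda>(z, w). deriv (\<lambda>\<zeta>. f (z, \<zeta>)) w)"

definition everywhere_infinitesimally_extremal :: "(complex \<times> complex \<Rightarrow> complex) \<Rightarrow> bool" where
  "everywhere_infinitesimally_extremal f \<longleftrightarrow>
     (\<forall>(z, w) \<in> \<D>\<^sup>2.
        (1 - (cmod z)\<^sup>2) * cmod (partial_z f (z, w)) + (1 - (cmod w)\<^sup>2) * cmod (partial_w f (z, w))
          = 1 - (cmod (f (z, w)))\<^sup>2)"

end

theory Submission imports Defs begin

text \<open>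
  Let \<open>p = f\<^sub>z(0,0)\<close> and \<open>q = f\<^sub>w(0,0)\<close>, so that \<open>|p| + |q| = 1\<close>. For \<open>|\<psi>| = 1\<close> write
  \<open>f(x, x\<psi>) = x h(x)\<close> with \<open>|h| \<le> 1\<close> on the disk; then \<open>h(0) = p + q\<psi>\<close>, and \<open>h'(0) = Q(\<psi>)\<close> for a
  quadratic polynomial \<open>Q\<close>. The Schwarz-Pick bound \<open>|Q(\<psi>)| \<le> 1 - |p + q\<psi>|\<^sup>2\<close> vanishes to second
  order at some point of the circle, so \<open>Q\<close> has a double zero there. Comparing Laplacians in the
  extremality equation along \<open>w = 0\<close> gives \<open>|Q(0)| = |p||q|\<close>. Together these force
  \<open>Q(\<psi>) = -\<mu>\<psi>(1 - |p + q\<psi>|\<^sup>2)\<close> with \<open>|\<mu>| = 1\<close>: Schwarz-Pick is an equality on every slice, every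
  \<open>h\<close> is an explicit Moebius map, and \<open>f\<close> is known on \<open>|z| = |w|\<close>, hence everywhere.
  For the converse, the extremality equation of the rational function is an identity for the
  difference of the squared moduli of its denominator and numerator.
\<close>

section \<open>Schwarz-Pick at the origin\<close>

definition moebius_normalization :: "(complex \<Rightarrow> complex) \<Rightarrow> complex \<Rightarrow> complex" where
  "moebius_normalization h x = Moebius_function 0 (h 0) (h x)"

lemma moebius_normalization_0: "moebius_normalization h 0 = 0"
  by (simp add: moebius_normalization_def Moebius_function_eq_zero)

context
  fixes h :: "complex \<Rightarrow> complex"
  assumes holomorphic: "h holomorphic_on \<D>" and strict: "\<forall>x\<in>\<D>. cmod (h x) < 1"
begin

lemma holomorphic_moebius_normalization: "moebius_normalization h holomorphic_on \<D>"
  using holomorphic_on_compose_gen[OF holomorphic Moebius_function_holomorphic, of "h 0" 0] strict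
  by (auto simp: o_def moebius_normalization_def[abs_def] image_subset_iff)

lemma norm_moebius_normalization_less_1: "cmod x < 1 \<Longrightarrow> cmod (moebius_normalization h x) < 1"
  unfolding moebius_normalization_def using strict by (intro Moebius_function_norm_lt_1) auto

lemma deriv_moebius_normalization:
  "deriv (moebius_normalization h) 0 = deriv h 0 / of_real (1 - (cmod (h 0))\<^sup>2)"
proof -
  have "(cmod (h 0))\<^sup>2 < 1"
    using strict by (simp add: abs_square_less_1)
  then have denominator: "1 - cnj (h 0) * h 0 = of_real (1 - (cmod (h 0))\<^sup>2)" "1 - (cmod (h 0))\<^sup>2 \<noteq> 0"
    using complex_norm_square[of "h 0"] by (simp_all add: mult.commute)
  have "(h has_field_derivative deriv h 0) (at 0)"
    by (rule holomorphic_derivI[OF holomorphic]) auto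
  then have "((\<lambda>x. Moebius_function 0 (h 0) (h x)) has_field_derivative
      deriv h 0 / of_real (1 - (cmod (h 0))\<^sup>2)) (at 0)"
    unfolding Moebius_function_simple
    by - (rule derivative_eq_intros refl | assumption | use denominator in \<open>simp del: of_real_diff\<close>)+
  then show ?thesis
    unfolding moebius_normalization_def[abs_def] by (rule DERIV_imp_deriv)
qed

end

context
  fixes h :: "complex \<Rightarrow> complex"
  assumes holomorphic: "h holomorphic_on \<D>" and bounded: "\<And>x. x \<in> \<D> \<Longrightarrow> cmod (h x) \<le> 1"
begin

lemma schur_function_strict_or_constant:
  "(\<forall>x\<in>\<D>. cmod (h x) < 1) \<or> cmod (h 0) = 1 \<and> (\<forall>x\<in>\<D>. h x = h 0)"
proof (cases "\<exists>x\<in>\<D>. cmod (h x) = 1")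
  case True
  then obtain x where x: "x \<in> \<D>" "cmod (h x) = 1" by blast
  have "h constant_on \<D>"
    by (rule maximum_modulus_principle[OF holomorphic, of \<D> x]) (use x bounded in auto)
  then have "h y = h x" if "y \<in> \<D>" for y
    using that x(1) unfolding constant_on_def by metis
  then show ?thesis
    using x(2) by (metis centre_in_ball zero_less_one)
next
  case False
  then show ?thesis
    using bounded less_le by blast
qed

lemma schwarz_pick_origin: "cmod (deriv h 0) \<le> 1 - (cmod (h 0))\<^sup>2"
  using schur_function_strict_or_constant
proof (elim disjE conjE)
  assume strict: "\<forall>x\<in>\<D>. cmod (h x) < 1"
  have "cmod (deriv (moebius_normalization h) 0) \<le> 1"
    using Schwarz_Lemma(2)[OF holomorphic_moebius_normalization[OF holomorphic strict]
        moebius_normalization_0 norm_moebius_normalization_less_1[OF holomorphic strict], of 0] by simp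
  moreover have "1 - (cmod (h 0))\<^sup>2 > 0"
    using strict by (simp add: abs_square_less_1)
  ultimately show ?thesis
    unfolding deriv_moebius_normalization[OF holomorphic strict] norm_divide norm_of_real
    by (simp add: pos_divide_le_eq)
next
  assume unimodular: "cmod (h 0) = 1" and const: "\<forall>x\<in>\<D>. h x = h 0"
  have "(h has_field_derivative 0) (at 0)"
    by (rule has_field_derivative_transform_within_open[OF DERIV_const, where S = \<D>])
      (auto intro: const[rule_format, symmetric])
  then show ?thesis
    using unimodular by (simp add: DERIV_imp_deriv)
qed

lemma schwarz_pick_origin_equality:
  assumes \<omega>: "cmod \<omega> = 1" and dh: "deriv h 0 = \<omega> * of_real (1 - (cmod (h 0))\<^sup>2)" and x: "x \<in> \<D>"
  shows "h x * (1 + \<omega> * cnj (h 0) * x) = h 0 + \<omega> * x"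
  using schur_function_strict_or_constant
proof (elim disjE conjE)
  assume strict: "\<forall>x\<in>\<D>. cmod (h x) < 1"
  let ?k = "moebius_normalization h"
  have "1 - (cmod (h 0))\<^sup>2 > 0"
    using strict by (simp add: abs_square_less_1)
  then have deriv_k: "deriv ?k 0 = \<omega>"
    unfolding deriv_moebius_normalization[OF holomorphic strict] dh by (simp del: of_real_diff)
  then obtain \<alpha> where \<alpha>: "\<And>z. cmod z < 1 \<Longrightarrow> ?k z = \<alpha> * z"
    using Schwarz_Lemma(3)[OF holomorphic_moebius_normalization[OF holomorphic strict]
        moebius_normalization_0 norm_moebius_normalization_less_1[OF holomorphic strict], of 0] \<omega> by auto
  have "(?k has_field_derivative \<alpha>) (at 0)"
    by (rule has_field_derivative_transform_within_open[OF DERIV_cmult_Id, where S = \<D>]) (use \<alpha> in auto)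
  then have k_x: "(h x - h 0) / (1 - cnj (h 0) * h x) = \<omega> * x"
    using \<alpha>[of x] x deriv_k DERIV_imp_deriv
    by (auto simp: moebius_normalization_def Moebius_function_simple)
  have "cmod (cnj (h 0) * h x) < 1"
    using mult_strict_mono'[of "cmod (h 0)" 1 "cmod (h x)" 1] strict x by (simp add: norm_mult)
  then have "1 - cnj (h 0) * h x \<noteq> 0"
    by auto
  then have "h x - h 0 = \<omega> * x * (1 - cnj (h 0) * h x)"
    using k_x by (simp add: divide_eq_eq)
  then show ?thesis
    by (simp add: algebra_simps)
next
  assume unimodular: "cmod (h 0) = 1" and const: "\<forall>x\<in>\<D>. h x = h 0"
  have "h 0 * cnj (h 0) = 1"
    using unimodular by (simp flip: complex_norm_square)
  then show ?thesis
    unfolding const[rule_format, OF x] by algebra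
qed

end

section \<open>Second-order expansion of slices\<close>

lemma holomorphic_on_imp_isCont:
  assumes "k holomorphic_on S" and "open S" and "x \<in> S"
  shows "isCont k x"
  using holomorphic_on_imp_continuous_on[OF assms(1)] assms(2,3) by (simp add: continuous_on_eq_continuous_at)

definition origin_quotient :: "(complex \<Rightarrow> complex) \<Rightarrow> complex \<Rightarrow> complex" where
  "origin_quotient k w = (if w = 0 then deriv k 0 else (k w - k 0) / w)"

lemma origin_quotient_0 [simp]: "origin_quotient k 0 = deriv k 0"
  by (simp add: origin_quotient_def)

lemma eq_origin_quotient: "k w = k 0 + w * origin_quotient k w"
  by (simp add: origin_quotient_def)

lemma holomorphic_origin_quotient:
  assumes "k holomorphic_on S" and "open S"
  shows "origin_quotient k holomorphic_on S"
  using pole_lemma_open[OF assms, of 0] by (simp add: origin_quotient_def[abs_def] cong: if_cong)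

lemma deriv_origin_quotient:
  assumes k: "k holomorphic_on S" and S: "open S" "0 \<in> S"
  shows "deriv (origin_quotient k) 0 = deriv (deriv k) 0 / 2"
proof -
  let ?h = "origin_quotient k"
  have h: "?h holomorphic_on S"
    using k S(1) by (rule holomorphic_origin_quotient)
  have "deriv k z = ?h z + z * deriv ?h z" if "z \<in> S" for z
  proof -
    have "((\<lambda>z. k 0 + z * ?h z) has_field_derivative ?h z + z * deriv ?h z) (at z)"
      using holomorphic_derivI[OF h S(1) that] by (auto intro!: derivative_eq_intros)
    then show ?thesis
      by (simp add: DERIV_imp_deriv flip: eq_origin_quotient)
  qed
  moreover have "((\<lambda>z. ?h z + z * deriv ?h z) has_field_derivative 2 * deriv ?h 0) (at 0)"
    using holomorphic_derivI[OF h S] holomorphic_derivI[OF holomorphic_deriv[OF h S(1)] S]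
    by (auto intro!: derivative_eq_intros)
  ultimately have "(deriv k has_field_derivative 2 * deriv ?h 0) (at 0)"
    using has_field_derivative_transform_within_open S by fastforce
  then show ?thesis
    by (simp add: DERIV_imp_deriv)
qed

lemma origin_quotient_second_order:
  assumes S: "open S" "0 \<in> S" and g: "\<And>x. x \<in> S \<Longrightarrow> g x = c0 + x * c1 + x\<^sup>2 * r x" and r: "isCont r 0"
  shows "deriv g 0 = c1" and "deriv (origin_quotient g) 0 = r 0"
proof -
  have g0: "g 0 = c0"
    using g[OF S(2)] by simp
  have near: "\<forall>\<^sub>F x in at 0. x \<in> S \<and> x \<noteq> 0"
    using eventually_at_in_open[OF S] by simp
  have "((\<lambda>x. c1 + x * r x) \<longlongrightarrow> c1 + 0 * r 0) (at 0)"
    using r unfolding isCont_def by (intro tendsto_intros)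
  moreover have "\<forall>\<^sub>F x in at 0. c1 + x * r x = (g x - g 0) / x"
    using near by eventually_elim (simp add: g g0 field_simps power2_eq_square)
  ultimately have "(g has_field_derivative c1) (at 0)"
    unfolding has_field_derivative_iff using Lim_transform_eventually by force
  then show dg: "deriv g 0 = c1"
    by (rule DERIV_imp_deriv)
  have "\<forall>\<^sub>F x in at 0. r x = (origin_quotient g x - origin_quotient g 0) / x"
    using near by eventually_elim (simp add: dg g g0 origin_quotient_def field_simps power2_eq_square)
  then have "(origin_quotient g has_field_derivative r 0) (at 0)"
    using r unfolding has_field_derivative_iff isCont_def by (simp add: Lim_transform_eventually)
  then show "deriv (origin_quotient g) 0 = r 0"
    by (rule DERIV_imp_deriv)
qed

lemma norm_origin_quotient_le_1:
  assumes "g holomorphic_on \<D>" and "g 0 = 0" and "\<And>x. cmod x < 1 \<Longrightarrow> cmod (g x) < 1" and "x \<in> \<D>"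
  shows "cmod (origin_quotient g x) \<le> 1"
  using Schwarz_Lemma(1,2)[OF assms(1-3), of x] assms(2,4)
  by (simp add: origin_quotient_def norm_divide divide_le_eq_1)

lemma norm_origin_quotient_le:
  assumes k: "k holomorphic_on \<D>" and M: "\<And>w. w \<in> \<D> \<Longrightarrow> cmod (k w) \<le> M" and w: "w \<in> \<D>"
  shows "cmod (origin_quotient k w) \<le> 2 * M + 1"
proof -
  define u where "u = (\<lambda>w. (k w - k 0) / of_real (2 * M + 1))"
  have pos: "2 * M + 1 > 0"
    using M[of 0] norm_ge_zero[of "k 0"] by (simp del: norm_ge_zero)
  have u: "u holomorphic_on \<D>"
    unfolding u_def using k by (intro holomorphic_intros) (use pos in auto)
  have "cmod (u x) < 1" if "cmod x < 1" for x
    using norm_triangle_ineq4[of "k x" "k 0"] M[of x] M[of 0] that pos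
    by (simp add: u_def norm_divide del: of_real_add of_real_mult)
  moreover have "u 0 = 0"
    by (simp add: u_def)
  ultimately have "cmod (origin_quotient u w) \<le> 1"
    using norm_origin_quotient_le_1[OF u] w by blast
  moreover have "origin_quotient u w = origin_quotient k w / of_real (2 * M + 1)"
  proof -
    have "(u has_field_derivative deriv k 0 / of_real (2 * M + 1)) (at 0)"
      unfolding u_def using holomorphic_derivI[OF k, of 0] pos
      by (auto intro!: derivative_eq_intros simp del: of_real_add of_real_mult)
    then show ?thesis
      by (simp add: origin_quotient_def DERIV_imp_deriv u_def)
  qed
  ultimately show ?thesis
    using pos by (simp add: norm_divide del: of_real_add of_real_mult)
qed

lemma norm_diff_origin_le:
  assumes "k holomorphic_on \<D>" and "\<And>w. w \<in> \<D> \<Longrightarrow> cmod (k w) \<le> M" and "w \<in> \<D>"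
  shows "cmod (k w - k 0) \<le> (2 * M + 1) * cmod w"
proof -
  have "cmod (k w - k 0) = cmod w * cmod (origin_quotient k w)"
    using eq_origin_quotient[of k w] by (metis add_diff_cancel_left' norm_mult)
  then show ?thesis
    using norm_origin_quotient_le[OF assms] by (metis mult.commute mult_left_mono norm_ge_zero)
qed

lemma holomorphic_on_uniform_limit:
  assumes S: "open S" and f: "\<forall>\<^sub>F n in F. f n holomorphic_on S" and lim: "uniform_limit S f g F"
    and F: "F \<noteq> bot"
  shows "g holomorphic_on S"
proof -
  have "\<exists>d>0. g holomorphic_on ball x d" if x: "x \<in> S" for x
  proof -
    obtain d where d: "d > 0" "cball x d \<subseteq> S"
      using S x by (metis open_contains_cball)
    have "\<forall>\<^sub>F n in F. continuous_on (cball x d) (f n) \<and> f n holomorphic_on ball x d"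
      using f
    proof eventually_elim
      case (elim n)
      then have "f n holomorphic_on cball x d"
        using d(2) by (rule holomorphic_on_subset)
      then show ?case
        by (simp add: holomorphic_on_imp_continuous_on holomorphic_on_subset[OF _ ball_subset_cball])
    qed
    then have "g holomorphic_on ball x d"
      using holomorphic_uniform_limit[OF _ uniform_limit_on_subset[OF lim d(2)] F] by blast
    with d show ?thesis by blast
  qed
  then have "g analytic_on S"
    unfolding analytic_on_def by blast
  then show ?thesis
    by (rule analytic_imp_holomorphic)
qed

lemma uniform_limit_at_origin:
  assumes "\<And>z. z \<in> S \<Longrightarrow> k z holomorphic_on \<D>"
    and "\<And>z w. z \<in> S \<Longrightarrow> w \<in> \<D> \<Longrightarrow> cmod (k z w) \<le> M"
  shows "uniform_limit S (\<lambda>w z. k z w) (\<lambda>z. k z 0) (at 0)"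
proof (rule uniform_limitI)
  fix e :: real assume "e > 0"
  moreover have "((\<lambda>w. (2 * M + 1) * cmod w) \<longlongrightarrow> 0) (at 0)"
    by (auto intro!: tendsto_eq_intros)
  ultimately have "\<forall>\<^sub>F w in at 0. (2 * M + 1) * cmod w < e"
    using order_tendstoD(2) by blast
  moreover have "\<forall>\<^sub>F w in at 0. w \<in> \<D>"
    using eventually_at_in_open'[of \<D> 0] by auto
  ultimately show "\<forall>\<^sub>F w in at 0. \<forall>z\<in>S. dist (k z w) (k z 0) < e"
  proof eventually_elim
    case (elim w)
    then show ?case
      unfolding dist_norm using norm_diff_origin_le[OF assms] order_le_less_trans by blast
  qed
qed

definition separately_holomorphic_bounded :: "(complex \<Rightarrow> complex \<Rightarrow> complex) \<Rightarrow> bool" where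
  "separately_holomorphic_bounded F \<longleftrightarrow>
     (\<forall>w\<in>\<D>. (\<lambda>z. F z w) holomorphic_on \<D>) \<and> (\<forall>z\<in>\<D>. F z holomorphic_on \<D>) \<and>
     (\<exists>M. \<forall>z\<in>\<D>. \<forall>w\<in>\<D>. cmod (F z w) \<le> M)"

lemma separately_holomorphic_bounded_origin_quotient:
  assumes F: "separately_holomorphic_bounded F"
  shows "separately_holomorphic_bounded (\<lambda>z. origin_quotient (F z))"
proof -
  let ?Q = "\<lambda>z. origin_quotient (F z)"
  obtain M where Fz: "\<And>w. w \<in> \<D> \<Longrightarrow> (\<lambda>z. F z w) holomorphic_on \<D>"
    and Fw: "\<And>z. z \<in> \<D> \<Longrightarrow> F z holomorphic_on \<D>"
    and M: "\<And>z w. z \<in> \<D> \<Longrightarrow> w \<in> \<D> \<Longrightarrow> cmod (F z w) \<le> M"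
    using F unfolding separately_holomorphic_bounded_def by blast
  have holomorphic_w: "?Q z holomorphic_on \<D>" if "z \<in> \<D>" for z
    using Fw[OF that] by (simp add: holomorphic_origin_quotient)
  have bound: "cmod (?Q z w) \<le> 2 * M + 1" if "z \<in> \<D>" "w \<in> \<D>" for z w
    using norm_origin_quotient_le[OF Fw M] that by blast
  have holomorphic_z: "(\<lambda>z. ?Q z w) holomorphic_on \<D>" if "w \<in> \<D>" "w \<noteq> 0" for w
    using Fz[of w] Fz[of 0] that by (auto simp: origin_quotient_def intro!: holomorphic_intros)
  have holomorphic_axis: "(\<lambda>z. ?Q z 0) holomorphic_on \<D>"
  proof (rule holomorphic_on_uniform_limit)
    show "\<forall>\<^sub>F w in at 0. (\<lambda>z. ?Q z w) holomorphic_on \<D>"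
      using holomorphic_z by (auto simp: eventually_at intro!: exI[of _ 1])
    show "uniform_limit \<D> (\<lambda>w z. ?Q z w) (\<lambda>z. ?Q z 0) (at 0)"
      using holomorphic_w bound by (rule uniform_limit_at_origin)
  qed auto
  show ?thesis
    unfolding separately_holomorphic_bounded_def
    using holomorphic_z holomorphic_axis holomorphic_w bound by metis
qed

lemma isCont_separately_holomorphic_bounded:
  assumes F: "separately_holomorphic_bounded F"
  shows "isCont (\<lambda>x. F x (x * c)) 0"
proof -
  obtain M where M: "\<And>z w. z \<in> \<D> \<Longrightarrow> w \<in> \<D> \<Longrightarrow> cmod (F z w) \<le> M"
    using F unfolding separately_holomorphic_bounded_def by blast
  have "isCont (\<lambda>x. F x 0) 0"
    using F by (intro holomorphic_on_imp_isCont[of _ \<D>]) (auto simp: separately_holomorphic_bounded_def)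
  moreover have "((\<lambda>x. F x (x * c) - F x 0) \<longlongrightarrow> 0) (at 0)"
  proof (rule Lim_null_comparison)
    have lim: "((\<lambda>x. x * c) \<longlongrightarrow> 0) (at 0)"
      by (auto intro!: tendsto_eq_intros)
    have "\<forall>\<^sub>F x in at 0. x \<in> \<D>"
      using eventually_at_in_open'[of \<D> 0] by auto
    moreover have "\<forall>\<^sub>F x in at 0. x * c \<in> \<D>"
      using topological_tendstoD[OF lim, of \<D>] by auto
    ultimately show "\<forall>\<^sub>F x in at 0. cmod (F x (x * c) - F x 0) \<le> (2 * M + 1) * cmod (x * c)"
    proof eventually_elim
      case (elim x)
      with F M show ?case
        by (intro norm_diff_origin_le) (auto simp: separately_holomorphic_bounded_def)
    qed
    show "((\<lambda>x. (2 * M + 1) * cmod (x * c)) \<longlongrightarrow> 0) (at 0)"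
      by (auto intro!: tendsto_eq_intros)
  qed
  ultimately show ?thesis
    unfolding isCont_def using tendsto_add by fastforce
qed

lemma holomorphic_partial_w_axis:
  assumes "separately_holomorphic_bounded (\<lambda>z w. f (z, w))"
  shows "(\<lambda>z. partial_w f (z, 0)) holomorphic_on \<D>"
  using separately_holomorphic_bounded_origin_quotient[OF assms]
  by (auto simp: separately_holomorphic_bounded_def partial_w_def dest: bspec[of _ _ 0])

text \<open>Half the second derivative of \<open>x \<mapsto> f (x, x * \<psi>)\<close> at the origin.\<close>

definition second_order_form :: "(complex \<times> complex \<Rightarrow> complex) \<Rightarrow> complex \<Rightarrow> complex" where
  "second_order_form f \<psi> =
     deriv (\<lambda>z. partial_z f (z, 0)) 0 / 2 + deriv (\<lambda>z. partial_w f (z, 0)) 0 * \<psi>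
       + deriv (\<lambda>w. partial_w f (0, w)) 0 / 2 * \<psi>\<^sup>2"

lemma slice_second_order:
  assumes f: "separately_holomorphic_bounded (\<lambda>z w. f (z, w))"
  shows "deriv (\<lambda>x. f (x, x * \<psi>)) 0 = partial_z f (0, 0) + partial_w f (0, 0) * \<psi>"
    and "deriv (origin_quotient (\<lambda>x. f (x, x * \<psi>))) 0 = second_order_form f \<psi>"
proof -
  define \<phi> \<kappa> where "\<phi> = (\<lambda>z. f (z, 0))" and "\<kappa> = (\<lambda>z. partial_w f (z, 0))"
  define Q G where "Q = (\<lambda>z. origin_quotient (\<lambda>w. f (z, w)))" and "G = (\<lambda>z. origin_quotient (Q z))"
  have G: "separately_holomorphic_bounded G"
    unfolding Q_def G_def by (intro separately_holomorphic_bounded_origin_quotient f)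
  have Q_axis: "Q z 0 = \<kappa> z" for z
    by (simp add: Q_def \<kappa>_def partial_w_def)
  have \<phi>: "\<phi> holomorphic_on \<D>"
    using f by (simp add: separately_holomorphic_bounded_def \<phi>_def)
  have \<kappa>: "\<kappa> holomorphic_on \<D>"
    unfolding \<kappa>_def using f by (rule holomorphic_partial_w_axis)
  define r where "r = (\<lambda>x. origin_quotient (origin_quotient \<phi>) x + \<psi> * origin_quotient \<kappa> x
      + \<psi>\<^sup>2 * G x (x * \<psi>))"
  have expansion: "f (x, x * \<psi>) = f (0, 0) + x * (deriv \<phi> 0 + \<psi> * \<kappa> 0) + x\<^sup>2 * r x" for x
  proof -
    have "f (x, x * \<psi>) = \<phi> x + x * \<psi> * (\<kappa> x + x * \<psi> * G x (x * \<psi>))"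
      using eq_origin_quotient[of "\<lambda>w. f (x, w)" "x * \<psi>"] eq_origin_quotient[of "Q x" "x * \<psi>"]
      by (simp add: \<phi>_def G_def flip: Q_axis) (simp add: Q_def)
    moreover have "\<phi> x = f (0, 0) + x * (deriv \<phi> 0 + x * origin_quotient (origin_quotient \<phi>) x)"
      using eq_origin_quotient[of \<phi> x] eq_origin_quotient[of "origin_quotient \<phi>" x] by (simp add: \<phi>_def)
    ultimately show ?thesis
      using eq_origin_quotient[of \<kappa> x] by (simp add: r_def power2_eq_square algebra_simps)
  qed
  have r: "isCont r 0"
    unfolding r_def using \<phi> \<kappa>
    by (intro continuous_intros isCont_separately_holomorphic_bounded[OF G]
        holomorphic_on_imp_isCont[of _ \<D>] holomorphic_origin_quotient) auto
  note second_order = origin_quotient_second_order[OF open_UNIV UNIV_I expansion r]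
  show "deriv (\<lambda>x. f (x, x * \<psi>)) 0 = partial_z f (0, 0) + partial_w f (0, 0) * \<psi>"
    using second_order(1) by (simp add: \<phi>_def \<kappa>_def partial_z_def mult.commute)
  have G_origin: "G 0 0 = deriv (\<lambda>w. partial_w f (0, w)) 0 / 2"
    using f deriv_origin_quotient[of "\<lambda>w. f (0, w)" \<D>]
    by (simp add: G_def Q_def partial_w_def separately_holomorphic_bounded_def)
  have deriv_\<phi>_quotient: "deriv (origin_quotient \<phi>) 0 = deriv (\<lambda>z. partial_z f (z, 0)) 0 / 2"
    using deriv_origin_quotient[OF \<phi> open_ball] by (simp add: \<phi>_def partial_z_def)
  show "deriv (origin_quotient (\<lambda>x. f (x, x * \<psi>))) 0 = second_order_form f \<psi>"
    unfolding second_order(2) second_order_form_def by (simp add: r_def \<kappa>_def G_origin deriv_\<phi>_quotient mult.commute)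
qed

section \<open>The five-point Laplacian\<close>

text \<open>Summing over the fourth roots of unity cancels the terms of order \<open>z\<close> and \<open>z\<^sup>2\<close> in the expansion of \<open>u\<close>
  and keeps the one of order \<open>|z|\<^sup>2\<close>.\<close>

definition five_point_laplacian :: "(complex \<Rightarrow> real) \<Rightarrow> real \<Rightarrow> real" where
  "five_point_laplacian u r = (\<Sum>c\<in>{1, \<i>, - 1, - \<i>}. u (c * of_real r) - u 0) / r\<^sup>2"

lemma sum_fourth_roots_of_unity:
  fixes g :: "complex \<Rightarrow> 'a :: comm_monoid_add"
  shows "(\<Sum>c\<in>{1, \<i>, - 1, - \<i>}. g c) = g 1 + (g \<i> + (g (- 1) + g (- \<i>)))"
  by (simp add: complex_eq_iff)

lemma five_point_laplacian_const: "five_point_laplacian (\<lambda>z. k) r = 0"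
  by (simp add: five_point_laplacian_def)

lemma five_point_laplacian_add:
  "five_point_laplacian (\<lambda>z. u z + v z) r = five_point_laplacian u r + five_point_laplacian v r"
  by (simp add: five_point_laplacian_def sum_fourth_roots_of_unity add_divide_distrib diff_divide_distrib)

lemma five_point_laplacian_radial_weight:
  assumes "r \<noteq> 0"
  shows "five_point_laplacian (\<lambda>z. (1 - (cmod z)\<^sup>2) * u z) r = (1 - r\<^sup>2) * five_point_laplacian u r - 4 * u 0"
proof -
  let ?K = "{1, \<i>, - 1, - \<i>}"
  have "(\<Sum>c\<in>?K. (1 - (cmod (c * of_real r))\<^sup>2) * u (c * of_real r) - (1 - (cmod 0)\<^sup>2) * u 0)
      = (\<Sum>c\<in>?K. (1 - r\<^sup>2) * (u (c * of_real r) - u 0) - r\<^sup>2 * u 0)"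
    by (intro sum.cong refl) (auto simp: norm_mult algebra_simps)
  also have "\<dots> = (1 - r\<^sup>2) * (\<Sum>c\<in>?K. u (c * of_real r) - u 0) - r\<^sup>2 * (4 * u 0)"
    by (simp only: sum_subtractf sum_fourth_roots_of_unity flip: sum_distrib_left) simp
  finally show ?thesis
    unfolding five_point_laplacian_def using assms by (simp add: diff_divide_distrib)
qed

lemma five_point_laplacian_norm_square:
  fixes P q :: "complex \<Rightarrow> complex"
  assumes P: "\<And>z. P z = a + z * (b + z * q z)" and r: "r \<noteq> 0"
  shows "five_point_laplacian (\<lambda>z. (cmod (P z))\<^sup>2) r
    = (\<Sum>c\<in>{1, \<i>, - 1, - \<i>}. 2 * Re (cnj a * (c\<^sup>2 * q (c * of_real r)))
        + (cmod (b * c + of_real r * (c\<^sup>2 * q (c * of_real r))))\<^sup>2)"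
    (is "_ = (\<Sum>c\<in>?K. ?T c)")
proof -
  define T where "T = ?T"
  have "(cmod (P (c * of_real r)))\<^sup>2 - (cmod (P 0))\<^sup>2 = 2 * r * Re (cnj a * b * c) + r\<^sup>2 * T c" for c
  proof -
    have "P (c * of_real r) = a + of_real r * (b * c + of_real r * (c\<^sup>2 * q (c * of_real r)))"
      unfolding P by (simp add: power2_eq_square algebra_simps)
    moreover have "(cmod (a + of_real r * (x + of_real r * y)))\<^sup>2 - (cmod a)\<^sup>2
        = 2 * r * Re (cnj a * x) + r\<^sup>2 * (2 * Re (cnj a * y) + (cmod (x + of_real r * y))\<^sup>2)" for x y
      by (simp add: cmod_power2) (simp add: power2_eq_square algebra_simps)
    ultimately show ?thesis
      by (simp add: P[of 0] T_def mult.assoc)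
  qed
  then have "(\<Sum>c\<in>?K. (cmod (P (c * of_real r)))\<^sup>2 - (cmod (P 0))\<^sup>2)
      = 2 * r * (\<Sum>c\<in>?K. Re (cnj a * b * c)) + r\<^sup>2 * (\<Sum>c\<in>?K. T c)"
    by (simp only: sum.distrib sum_distrib_left)
  also have "(\<Sum>c\<in>?K. Re (cnj a * b * c)) = 0"
    unfolding sum_fourth_roots_of_unity by simp
  finally show ?thesis
    using r by (simp add: five_point_laplacian_def T_def)
qed

lemma tendsto_five_point_laplacian_norm_square:
  assumes P: "P holomorphic_on S" and S: "open S" "0 \<in> S"
  shows "(five_point_laplacian (\<lambda>z. (cmod (P z))\<^sup>2) \<longlongrightarrow> 4 * (cmod (deriv P 0))\<^sup>2) (at 0)"
proof -
  let ?K = "{1, \<i>, - 1, - \<i>}"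
  define q where "q = origin_quotient (origin_quotient P)"
  have P_eq: "P z = P 0 + z * (deriv P 0 + z * q z)" for z
    using eq_origin_quotient[of P z] eq_origin_quotient[of "origin_quotient P" z] by (simp add: q_def)
  have "isCont q 0"
    unfolding q_def using P S by (intro holomorphic_on_imp_isCont[of _ S] holomorphic_origin_quotient)
  then have q: "((\<lambda>r. q (c * of_real r)) \<longlongrightarrow> q 0) (at (0::real))" for c
    by (rule isCont_tendsto_compose) (auto intro!: tendsto_eq_intros)
  have "((\<lambda>r. \<Sum>c\<in>?K. 2 * Re (cnj (P 0) * (c\<^sup>2 * q (c * of_real r)))
        + (cmod (deriv P 0 * c + of_real r * (c\<^sup>2 * q (c * of_real r))))\<^sup>2)
      \<longlongrightarrow> (\<Sum>c\<in>?K. 2 * Re (cnj (P 0) * (c\<^sup>2 * q 0))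
        + (cmod (deriv P 0 * c + of_real 0 * (c\<^sup>2 * q 0)))\<^sup>2)) (at 0)"
    by (intro tendsto_intros q)
  moreover have "(\<Sum>c\<in>?K. 2 * Re (cnj (P 0) * (c\<^sup>2 * q 0))
      + (cmod (deriv P 0 * c + of_real 0 * (c\<^sup>2 * q 0)))\<^sup>2) = 4 * (cmod (deriv P 0))\<^sup>2"
    unfolding sum_fourth_roots_of_unity by (simp add: norm_mult)
  ultimately show ?thesis
    by (simp only:)
      (erule Lim_transform_eventually, simp add: eventually_at_filter five_point_laplacian_norm_square[OF P_eq])
qed

lemma five_point_laplacian_eventually_cong:
  assumes "open S" and "0 \<in> S" and "\<And>z. z \<in> S \<Longrightarrow> u z = v z"
  shows "\<forall>\<^sub>F r in at 0. five_point_laplacian u r = five_point_laplacian v r"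
proof -
  have "\<forall>\<^sub>F r in at (0::real). c * of_real r \<in> S" for c
    using assms(1,2) by (intro topological_tendstoD[where l = 0]) (auto intro!: tendsto_eq_intros)
  then have "\<forall>\<^sub>F r in at 0. \<forall>c\<in>{1, \<i>, - 1, - \<i>}. c * of_real r \<in> S"
    by (intro eventually_ball_finite) auto
  then show ?thesis
    by eventually_elim (simp add: five_point_laplacian_def sum_fourth_roots_of_unity assms(2,3))
qed

text \<open>A holomorphic square root turns \<open>|u|\<close> into a squared modulus.\<close>

lemma tendsto_five_point_laplacian_norm:
  assumes u: "u holomorphic_on S" and S: "open S" "0 \<in> S" and u0: "u 0 \<noteq> 0"
  shows "(five_point_laplacian (\<lambda>z. cmod (u z)) \<longlongrightarrow> (cmod (deriv u 0))\<^sup>2 / cmod (u 0)) (at 0)"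
proof -
  have "isCont u 0"
    using u S by (rule holomorphic_on_imp_isCont)
  then obtain d where d: "d > 0" "\<And>z. z \<in> ball 0 d \<Longrightarrow> u z \<noteq> 0"
    using continuous_at_avoid[of 0 u 0] u0 by (auto simp: dist_commute)
  obtain d' where d': "d' > 0" "ball 0 d' \<subseteq> S"
    using S open_contains_ball by metis
  define B :: "complex set" where "B = ball 0 (min d d')"
  have B: "open B" "0 \<in> B"
    using d(1) d'(1) by (simp_all add: B_def)
  have "u holomorphic_on B"
    using u by (rule holomorphic_on_subset) (use d' in \<open>auto simp: B_def\<close>)
  then obtain P where P: "P holomorphic_on B" and uP: "\<And>z. z \<in> B \<Longrightarrow> u z = (P z)\<^sup>2"
    using contractible_imp_holomorphic_sqrt[of u B] d(2) convex_imp_contractible[of B] by (auto simp: B_def)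
  have "((\<lambda>z. (P z)\<^sup>2) has_field_derivative 2 * P 0 * deriv P 0) (at 0)"
    using holomorphic_derivI[OF P B] by (auto intro!: derivative_eq_intros)
  then have "(u has_field_derivative 2 * P 0 * deriv P 0) (at 0)"
    by (rule has_field_derivative_transform_within_open[OF _ B]) (simp add: uP)
  then have "4 * (cmod (deriv P 0))\<^sup>2 = (cmod (deriv u 0))\<^sup>2 / cmod (u 0)"
    using uP[OF B(2)] u0 by (simp add: DERIV_imp_deriv norm_mult norm_power power_mult_distrib)
  moreover have "\<forall>\<^sub>F r in at 0.
      five_point_laplacian (\<lambda>z. (cmod (P z))\<^sup>2) r = five_point_laplacian (\<lambda>z. cmod (u z)) r"
    using B by (rule five_point_laplacian_eventually_cong) (simp add: uP norm_power)
  ultimately show ?thesis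
    using tendsto_five_point_laplacian_norm_square[OF P B] Lim_transform_eventually by fastforce
qed

lemma extremal_equation_second_order:
  assumes p: "p holomorphic_on \<D>" and q: "q holomorphic_on \<D>" and \<phi>: "\<phi> holomorphic_on \<D>"
    and "p 0 \<noteq> 0" and "q 0 \<noteq> 0"
    and extremal: "\<And>z. z \<in> \<D> \<Longrightarrow> (1 - (cmod z)\<^sup>2) * cmod (p z) + cmod (q z) = 1 - (cmod (\<phi> z))\<^sup>2"
  shows "(cmod (deriv p 0))\<^sup>2 / cmod (p 0) + (cmod (deriv q 0))\<^sup>2 / cmod (q 0) + 4 * (cmod (deriv \<phi> 0))\<^sup>2
    = 4 * cmod (p 0)"
proof -
  let ?L = five_point_laplacian
  have disk: "open \<D>" "(0::complex) \<in> \<D>" by auto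
  have "((\<lambda>r. (1 - r\<^sup>2) * ?L (\<lambda>z. cmod (p z)) r - 4 * cmod (p 0)
        + ?L (\<lambda>z. cmod (q z)) r + ?L (\<lambda>z. (cmod (\<phi> z))\<^sup>2) r)
      \<longlongrightarrow> (1 - 0\<^sup>2) * ((cmod (deriv p 0))\<^sup>2 / cmod (p 0)) - 4 * cmod (p 0)
        + (cmod (deriv q 0))\<^sup>2 / cmod (q 0) + 4 * (cmod (deriv \<phi> 0))\<^sup>2) (at 0)"
    using assms disk
    by (intro tendsto_intros tendsto_five_point_laplacian_norm tendsto_five_point_laplacian_norm_square)
  moreover have "\<forall>\<^sub>F r in at 0. (1 - r\<^sup>2) * ?L (\<lambda>z. cmod (p z)) r - 4 * cmod (p 0)
      + ?L (\<lambda>z. cmod (q z)) r + ?L (\<lambda>z. (cmod (\<phi> z))\<^sup>2) r = 0"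
  proof -
    have "\<forall>\<^sub>F r in at 0. ?L (\<lambda>z. (1 - (cmod z)\<^sup>2) * cmod (p z) + cmod (q z) + (cmod (\<phi> z))\<^sup>2) r = ?L (\<lambda>z. 1) r"
      using disk by (rule five_point_laplacian_eventually_cong) (simp add: extremal)
    moreover have "\<forall>\<^sub>F r in at (0::real). r \<noteq> 0"
      by (simp add: eventually_at_filter)
    ultimately show ?thesis
      by eventually_elim
        (simp add: five_point_laplacian_add five_point_laplacian_radial_weight five_point_laplacian_const)
  qed
  ultimately have "((\<lambda>_::real. 0::real) \<longlongrightarrow> (1 - 0\<^sup>2) * ((cmod (deriv p 0))\<^sup>2 / cmod (p 0)) - 4 * cmod (p 0)
        + (cmod (deriv q 0))\<^sup>2 / cmod (q 0) + 4 * (cmod (deriv \<phi> 0))\<^sup>2) (at 0)"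
    by (rule Lim_transform_eventually)
  then show ?thesis
    using tendsto_unique[OF trivial_limit_at tendsto_const] by fastforce
qed

section \<open>Uniqueness on circles\<close>

lemma islimpt_circle:
  fixes x :: complex
  assumes "x \<noteq> 0"
  shows "x islimpt sphere 0 (cmod x)"
proof (rule connected_imp_perfect)
  show "connected (sphere (0::complex) (cmod x))"
    by (rule connected_sphere) simp
  have "x \<in> sphere 0 (cmod x)" "- x \<in> sphere 0 (cmod x)" "x \<noteq> - x"
    using assms by auto
  then show "sphere 0 (cmod x) \<noteq> {y}" for y :: complex
    by (metis singletonD)
qed simp

lemma quadratic_double_zero_on_circle:
  fixes A B C :: complex
  assumes bound: "\<And>\<psi>. cmod \<psi> = 1 \<Longrightarrow> cmod (A + B * \<psi> + C * \<psi>\<^sup>2) \<le> c * (cmod (1 - \<psi>))\<^sup>2"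
  shows "A + B * \<psi> + C * \<psi>\<^sup>2 = A * (1 - \<psi>)\<^sup>2"
proof -
  have B: "B = - A - C"
    using bound[of 1] by (simp add: algebra_simps eq_neg_iff_add_eq_0)
  have factor: "A + B * \<psi> + C * \<psi>\<^sup>2 = (A - C * \<psi>) * (1 - \<psi>)" for \<psi>
    by (simp add: B algebra_simps power2_eq_square)
  have "\<forall>\<^sub>F \<psi> in at 1 within sphere 0 1. cmod (A - C * \<psi>) \<le> c * cmod (1 - \<psi>)"
    unfolding eventually_at_filter
  proof (intro always_eventually allI impI)
    fix \<psi> :: complex assume "\<psi> \<noteq> 1" and "\<psi> \<in> sphere 0 1"
    then have \<psi>: "\<psi> \<noteq> 1" "cmod \<psi> = 1" by simp_all
    have "cmod (A - C * \<psi>) * cmod (1 - \<psi>) \<le> c * cmod (1 - \<psi>) * cmod (1 - \<psi>)"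
      using bound[OF \<psi>(2)] unfolding factor by (simp add: norm_mult power2_eq_square mult.assoc)
    then show "cmod (A - C * \<psi>) \<le> c * cmod (1 - \<psi>)"
      using \<psi>(1) by simp
  qed
  moreover have "at (1::complex) within sphere 0 1 \<noteq> bot"
    using islimpt_circle[of 1] by (simp add: trivial_limit_within)
  moreover have "((\<lambda>\<psi>. c * cmod (1 - \<psi>)) \<longlongrightarrow> c * cmod (1 - 1)) (at 1 within sphere 0 1)"
    "((\<lambda>\<psi>. cmod (A - C * \<psi>)) \<longlongrightarrow> cmod (A - C * 1)) (at 1 within sphere 0 1)"
    by (intro tendsto_intros)+
  ultimately have "cmod (A - C * 1) \<le> c * cmod (1 - 1 :: complex)"
    using tendsto_le by blast
  then have "C = A" by simp
  then show ?thesis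
    by (simp add: B algebra_simps power2_eq_square)
qed

lemma zero_if_zero_on_equal_moduli:
  fixes g :: "complex \<Rightarrow> complex \<Rightarrow> complex"
  assumes gz: "\<And>w. w \<in> \<D> \<Longrightarrow> (\<lambda>z. g z w) holomorphic_on \<D>"
    and gw: "\<And>z. z \<in> \<D> \<Longrightarrow> g z holomorphic_on \<D>"
    and zero: "\<And>z w. z \<in> \<D> \<Longrightarrow> z \<noteq> 0 \<Longrightarrow> cmod w = cmod z \<Longrightarrow> g z w = 0"
    and z: "z \<in> \<D>" and w: "w \<in> \<D>"
  shows "g z w = 0"
proof -
  have off_axis: "g x w = 0" if x: "x \<in> \<D> - {0}" for x
    by (rule analytic_continuation[OF gw, of x "sphere 0 (cmod x)" x])
      (use x w zero islimpt_circle in auto)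
  show ?thesis
    by (rule analytic_continuation[OF gz[OF w], of "\<D> - {0}" 0])
      (use off_axis z islimpt_punctured[of 0 \<D>] in \<open>auto simp: islimpt_ball\<close>)
qed

section \<open>Rigidity\<close>

lemma holomorphic2_on_compose:
  assumes f: "f holomorphic2_on T" and T: "open T" and S: "open S"
    and u: "u holomorphic_on S" and v: "v holomorphic_on S"
    and uv: "\<And>x. x \<in> S \<Longrightarrow> (u x, v x) \<in> T"
  shows "(\<lambda>x. f (u x, v x)) holomorphic_on S"
proof -
  have "\<exists>D. ((\<lambda>x. f (u x, v x)) has_field_derivative D) (at x)" if x: "x \<in> S" for x
  proof -
    obtain A B where "(f has_derivative (\<lambda>(h, k). A * h + B * k)) (at (u x, v x))"
      using f uv[OF x] at_within_open[OF uv[OF x] T] unfolding holomorphic2_on_def by metis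
    moreover have "((\<lambda>x. (u x, v x)) has_derivative (\<lambda>h. (deriv u x * h, deriv v x * h))) (at x)"
      using holomorphic_derivI[OF u S x] holomorphic_derivI[OF v S x]
      unfolding has_field_derivative_def by (intro has_derivative_Pair)
    ultimately have "((\<lambda>x. f (u x, v x)) has_derivative (\<lambda>h. (A * deriv u x + B * deriv v x) * h)) (at x)"
      using has_derivative_compose by (fastforce simp: algebra_simps)
    then show ?thesis
      unfolding has_field_derivative_def by blast
  qed
  then show ?thesis
    using S by (simp add: holomorphic_on_open)
qed

lemma cmod_mult_cis_Arg: "of_real (cmod z) * cis (Arg z) = z"
  using rcis_cmod_Arg[of z] by (simp add: rcis_def)

text \<open>The point \<open>cis (Arg p - Arg q)\<close> is where \<open>p + q\<psi>\<close> attains its maximal modulus \<open>1\<close> on the circle.\<close>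

lemma one_minus_norm_square_aligned:
  assumes pq: "cmod p + cmod q = 1" and \<sigma>: "cmod \<sigma> = 1"
  shows "1 - (cmod (p + q * (cis (Arg p - Arg q) * \<sigma>)))\<^sup>2 = cmod p * cmod q * (cmod (1 - \<sigma>))\<^sup>2"
proof -
  define t where "t = cmod p"
  have q: "cmod q = 1 - t"
    using pq by (simp add: t_def)
  have "q * (cis (Arg p - Arg q) * \<sigma>) = of_real (cmod q) * \<sigma> * cis (Arg p)"
    by (subst cmod_mult_cis_Arg[of q, symmetric]) (simp add: cis_mult flip: mult.assoc)
  then have "p + q * (cis (Arg p - Arg q) * \<sigma>) = (of_real t + of_real (1 - t) * \<sigma>) * cis (Arg p)"
    unfolding q by (simp only: distrib_right cmod_mult_cis_Arg t_def)
  moreover have "(Re \<sigma>)\<^sup>2 + (Im \<sigma>)\<^sup>2 = 1"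
    using \<sigma> by (simp flip: cmod_power2)
  then have "1 - (cmod (of_real t + of_real (1 - t) * \<sigma>))\<^sup>2 = t * (1 - t) * (cmod (1 - \<sigma>))\<^sup>2"
    unfolding cmod_power2 by (simp, algebra)
  ultimately show ?thesis
    by (simp only: norm_mult norm_cis mult_1_right q flip: t_def)
qed

lemma square_one_minus_unimodular:
  assumes "cmod \<sigma> = 1"
  shows "(1 - \<sigma>)\<^sup>2 = - \<sigma> * of_real ((cmod (1 - \<sigma>))\<^sup>2)"
proof -
  have "\<sigma> * cnj \<sigma> = 1"
    using assms by (simp flip: complex_norm_square)
  then show ?thesis
    unfolding complex_norm_square by simp algebra
qed

definition slice_quotient :: "(complex \<times> complex \<Rightarrow> complex) \<Rightarrow> complex \<Rightarrow> complex \<Rightarrow> complex" where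
  "slice_quotient f \<psi> = origin_quotient (\<lambda>x. f (x, x * \<psi>))"

context
  fixes f :: "complex \<times> complex \<Rightarrow> complex"
  assumes holomorphic: "f holomorphic2_on \<D>\<^sup>2" and self_map: "f \<in> \<D>\<^sup>2 \<rightarrow> \<D>"
    and fixes_origin: "f (0, 0) = 0"
begin

lemma holomorphic_compose_bidisk:
  assumes "u holomorphic_on \<D>" and "v holomorphic_on \<D>" and "\<And>x. x \<in> \<D> \<Longrightarrow> u x \<in> \<D> \<and> v x \<in> \<D>"
  shows "(\<lambda>x. f (u x, v x)) holomorphic_on \<D>"
  using assms by (intro holomorphic2_on_compose[OF holomorphic]) (auto simp: open_Times)

lemma norm_less_1_bidisk: "z \<in> \<D> \<Longrightarrow> w \<in> \<D> \<Longrightarrow> cmod (f (z, w)) < 1"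
  using funcset_mem[OF self_map, of "(z, w)"] by simp

lemma separately_holomorphic_bounded_bidisk: "separately_holomorphic_bounded (\<lambda>z w. f (z, w))"
  unfolding separately_holomorphic_bounded_def
  using norm_less_1_bidisk
  by (intro conjI ballI exI[of _ 1] holomorphic_compose_bidisk holomorphic_intros) (auto intro: less_imp_le)

lemma slice_eq: "f (x, x * \<psi>) = x * slice_quotient f \<psi> x"
  using eq_origin_quotient[of "\<lambda>x. f (x, x * \<psi>)" x] fixes_origin by (simp add: slice_quotient_def)

lemma slice_quotient_0: "slice_quotient f \<psi> 0 = partial_z f (0, 0) + partial_w f (0, 0) * \<psi>"
  using slice_second_order(1)[OF separately_holomorphic_bounded_bidisk] by (simp add: slice_quotient_def)

lemma deriv_slice_quotient: "deriv (slice_quotient f \<psi>) 0 = second_order_form f \<psi>"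
  using slice_second_order(2)[OF separately_holomorphic_bounded_bidisk] by (simp add: slice_quotient_def)

lemma slice_quotient_schur:
  assumes \<psi>: "cmod \<psi> = 1"
  shows "slice_quotient f \<psi> holomorphic_on \<D>"
    and "x \<in> \<D> \<Longrightarrow> cmod (slice_quotient f \<psi> x) \<le> 1"
proof -
  have slice: "(\<lambda>x. f (x, x * \<psi>)) holomorphic_on \<D>"
    using \<psi> by (intro holomorphic_compose_bidisk holomorphic_intros) (auto simp: norm_mult)
  then show "slice_quotient f \<psi> holomorphic_on \<D>"
    by (simp add: slice_quotient_def holomorphic_origin_quotient)
  have "cmod (f (x, x * \<psi>)) < 1" if "cmod x < 1" for x
    using norm_less_1_bidisk[of x "x * \<psi>"] that \<psi> by (simp add: norm_mult)
  then show "cmod (slice_quotient f \<psi> x) \<le> 1" if "x \<in> \<D>"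
    unfolding slice_quotient_def using slice fixes_origin that
    by (intro norm_origin_quotient_le_1) auto
qed

lemma norm_second_order_form_le:
  assumes "cmod \<psi> = 1"
  shows "cmod (second_order_form f \<psi>) \<le> 1 - (cmod (partial_z f (0, 0) + partial_w f (0, 0) * \<psi>))\<^sup>2"
  using schwarz_pick_origin[OF slice_quotient_schur[OF assms]]
  by (simp add: deriv_slice_quotient slice_quotient_0)

lemma second_order_form_aligned:
  fixes \<sigma> :: complex
  defines "p \<equiv> partial_z f (0, 0)" and "q \<equiv> partial_w f (0, 0)"
  assumes pq: "cmod p + cmod q = 1"
  shows "second_order_form f (cis (Arg p - Arg q) * \<sigma>) = second_order_form f 0 * (1 - \<sigma>)\<^sup>2"
proof -
  define A B C where "A = deriv (\<lambda>z. partial_z f (z, 0)) 0 / 2"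
    and "B = deriv (\<lambda>z. partial_w f (z, 0)) 0 * cis (Arg p - Arg q)"
    and "C = deriv (\<lambda>w. partial_w f (0, w)) 0 / 2 * (cis (Arg p - Arg q))\<^sup>2"
  have form: "second_order_form f (cis (Arg p - Arg q) * \<sigma>) = A + B * \<sigma> + C * \<sigma>\<^sup>2" for \<sigma>
    by (simp add: second_order_form_def A_def B_def C_def power_mult_distrib)
  have "cmod (A + B * \<sigma> + C * \<sigma>\<^sup>2) \<le> cmod p * cmod q * (cmod (1 - \<sigma>))\<^sup>2" if "cmod \<sigma> = 1" for \<sigma>
    using norm_second_order_form_le[of "cis (Arg p - Arg q) * \<sigma>"] one_minus_norm_square_aligned[OF pq that] that
    by (simp add: norm_mult flip: form p_def q_def)
  then have "A + B * \<sigma> + C * \<sigma>\<^sup>2 = A * (1 - \<sigma>)\<^sup>2"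
    by (rule quadratic_double_zero_on_circle)
  then show ?thesis
    using form[of 0] by (simp add: form)
qed

lemma norm_second_order_form_0_le:
  assumes pq: "cmod (partial_z f (0, 0)) + cmod (partial_w f (0, 0)) = 1"
  shows "cmod (second_order_form f 0) \<le> cmod (partial_z f (0, 0)) * cmod (partial_w f (0, 0))"
proof -
  define \<delta> where "\<delta> = cis (Arg (partial_z f (0, 0)) - Arg (partial_w f (0, 0)))"
  have "cmod (second_order_form f (\<delta> * (- 1)))
      \<le> 1 - (cmod (partial_z f (0, 0) + partial_w f (0, 0) * (\<delta> * (- 1))))\<^sup>2"
    by (rule norm_second_order_form_le) (simp add: \<delta>_def)
  also have "\<dots> = cmod (partial_z f (0, 0)) * cmod (partial_w f (0, 0)) * (cmod (1 - (- 1) :: complex))\<^sup>2"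
    unfolding \<delta>_def by (rule one_minus_norm_square_aligned[OF pq]) simp
  also have "second_order_form f (\<delta> * (- 1)) = second_order_form f 0 * (1 - (- 1))\<^sup>2"
    unfolding \<delta>_def by (rule second_order_form_aligned[OF pq])
  finally show ?thesis
    by (simp add: norm_mult)
qed

lemma norm_mixed_partial_origin:
  assumes pq: "cmod (partial_z f (0, 0)) + cmod (partial_w f (0, 0)) = 1"
  shows "cmod (deriv (\<lambda>z. partial_w f (z, 0)) 0) = 2 * cmod (second_order_form f 0)"
proof -
  define \<delta> where "\<delta> = cis (Arg (partial_z f (0, 0)) - Arg (partial_w f (0, 0)))"
  have "2 * (deriv (\<lambda>z. partial_w f (z, 0)) 0 * \<delta>)
      = second_order_form f (\<delta> * 1) - second_order_form f (\<delta> * (- 1))"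
    by (simp add: second_order_form_def)
  also have "\<dots> = - 4 * second_order_form f 0"
    unfolding \<delta>_def second_order_form_aligned[OF pq] by simp
  finally have "cmod (2 * (deriv (\<lambda>z. partial_w f (z, 0)) 0 * \<delta>)) = cmod (- 4 * second_order_form f 0)"
    by (rule arg_cong)
  then show ?thesis
    by (simp add: norm_mult \<delta>_def)
qed

context
  assumes extremal: "everywhere_infinitesimally_extremal f"
begin

lemma extremal_equation:
  assumes "z \<in> \<D>" and "w \<in> \<D>"
  shows "(1 - (cmod z)\<^sup>2) * cmod (partial_z f (z, w)) + (1 - (cmod w)\<^sup>2) * cmod (partial_w f (z, w))
    = 1 - (cmod (f (z, w)))\<^sup>2"
  using extremal assms unfolding everywhere_infinitesimally_extremal_def by blast

lemma norm_partials_origin: "cmod (partial_z f (0, 0)) + cmod (partial_w f (0, 0)) = 1"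
  using extremal_equation[of 0 0] fixes_origin by simp

lemma second_order_along_axis:
  assumes "partial_z f (0, 0) \<noteq> 0" and "partial_w f (0, 0) \<noteq> 0"
  shows "(cmod (deriv (\<lambda>z. partial_z f (z, 0)) 0))\<^sup>2 / cmod (partial_z f (0, 0))
      + (cmod (deriv (\<lambda>z. partial_w f (z, 0)) 0))\<^sup>2 / cmod (partial_w f (0, 0))
      + 4 * (cmod (partial_z f (0, 0)))\<^sup>2 = 4 * cmod (partial_z f (0, 0))"
proof -
  have axis: "(\<lambda>z. f (z, 0)) holomorphic_on \<D>"
    by (intro holomorphic_compose_bidisk holomorphic_intros) auto
  then have holomorphic_z: "(\<lambda>z. partial_z f (z, 0)) holomorphic_on \<D>"
    using holomorphic_deriv[OF axis] by (simp add: partial_z_def)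
  have holomorphic_w: "(\<lambda>z. partial_w f (z, 0)) holomorphic_on \<D>"
    by (rule holomorphic_partial_w_axis[OF separately_holomorphic_bounded_bidisk])
  have "deriv (\<lambda>z. f (z, 0)) 0 = partial_z f (0, 0)"
    by (simp add: partial_z_def)
  then show ?thesis
    using extremal_equation_second_order[OF holomorphic_z holomorphic_w axis assms] extremal_equation[of _ 0]
    by simp
qed

lemma norm_second_order_form_0:
  "cmod (second_order_form f 0) = cmod (partial_z f (0, 0)) * cmod (partial_w f (0, 0))"
proof (cases "partial_z f (0, 0) = 0 \<or> partial_w f (0, 0) = 0")
  case True
  then show ?thesis
    using norm_second_order_form_0_le[OF norm_partials_origin] by auto
next
  case False
  define s t where "s = cmod (partial_z f (0, 0))" and "t = cmod (partial_w f (0, 0))"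
  define A where "A = cmod (second_order_form f 0)"
  have st: "s > 0" "t > 0" "s + t = 1"
    using False norm_partials_origin by (simp_all add: s_def t_def)
  have "cmod (deriv (\<lambda>z. partial_z f (z, 0)) 0) = 2 * A"
    by (simp add: A_def second_order_form_def norm_divide)
  moreover have "cmod (deriv (\<lambda>z. partial_w f (z, 0)) 0) = 2 * A"
    unfolding A_def by (rule norm_mixed_partial_origin[OF norm_partials_origin])
  ultimately have "(2 * A)\<^sup>2 / s + (2 * A)\<^sup>2 / t + 4 * s\<^sup>2 = 4 * s"
    using second_order_along_axis False by (simp add: s_def t_def)
  moreover have "(2 * A)\<^sup>2 / s + (2 * A)\<^sup>2 / t = 4 * A\<^sup>2 * (s + t) / (s * t)"
    using st(1,2) by (simp add: divide_simps distrib_left)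
  moreover have "4 * s - 4 * s\<^sup>2 = 4 * (s * t)"
    using st(3) by algebra
  ultimately have "4 * A\<^sup>2 * (s + t) / (s * t) = 4 * (s * t)"
    by linarith
  then have "A\<^sup>2 = (s * t)\<^sup>2"
    using st(1,2) unfolding st(3) by (simp add: divide_eq_eq power2_eq_square)
  then show ?thesis
    using st by (simp add: power2_eq_iff_nonneg A_def s_def t_def)
qed

lemma second_order_form_extremal:
  obtains \<mu> where "cmod \<mu> = 1"
    and "\<And>\<psi>. cmod \<psi> = 1 \<Longrightarrow> second_order_form f \<psi>
      = - \<mu> * \<psi> * of_real (1 - (cmod (partial_z f (0, 0) + partial_w f (0, 0) * \<psi>))\<^sup>2)"
proof -
  define p q \<delta> where "p = partial_z f (0, 0)" and "q = partial_w f (0, 0)" and "\<delta> = cis (Arg p - Arg q)"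
  define A where "A = second_order_form f 0"
  define \<mu> where "\<mu> = cis (Arg A) * cnj \<delta>"
  have pq: "cmod p + cmod q = 1"
    unfolding p_def q_def by (rule norm_partials_origin)
  have A: "A = of_real (cmod p * cmod q) * cis (Arg A)"
    using cmod_mult_cis_Arg[of A] norm_second_order_form_0 by (simp add: A_def p_def q_def)
  have "second_order_form f \<psi> = - \<mu> * \<psi> * of_real (1 - (cmod (p + q * \<psi>))\<^sup>2)" if \<psi>: "cmod \<psi> = 1" for \<psi>
  proof -
    define \<sigma> where "\<sigma> = cnj \<delta> * \<psi>"
    have \<sigma>: "cmod \<sigma> = 1"
      using \<psi> by (simp add: \<sigma>_def \<delta>_def norm_mult)
    have \<psi>_eq: "\<psi> = \<delta> * \<sigma>"
      by (simp add: \<sigma>_def \<delta>_def cis_cnj cis_mult flip: mult.assoc)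
    have "second_order_form f \<psi> = A * (1 - \<sigma>)\<^sup>2"
      using second_order_form_aligned[of \<sigma>] pq by (simp add: \<psi>_eq \<delta>_def p_def q_def A_def)
    also have "\<dots> = - cis (Arg A) * \<sigma> * of_real (cmod p * cmod q * (cmod (1 - \<sigma>))\<^sup>2)"
      unfolding square_one_minus_unimodular[OF \<sigma>] by (subst A) simp
    also have "cmod p * cmod q * (cmod (1 - \<sigma>))\<^sup>2 = 1 - (cmod (p + q * \<psi>))\<^sup>2"
      using one_minus_norm_square_aligned[OF pq \<sigma>] by (simp add: \<psi>_eq \<delta>_def)
    finally show ?thesis
      by (simp add: \<mu>_def \<sigma>_def mult.assoc)
  qed
  moreover have "cmod \<mu> = 1"
    by (simp add: \<mu>_def \<delta>_def norm_mult)
  ultimately show thesis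
    using that by (simp add: p_def q_def)
qed

lemma extremal_rational_on_equal_moduli:
  obtains \<mu> where "cmod \<mu> = 1"
    and "\<And>z w. z \<in> \<D> \<Longrightarrow> z \<noteq> 0 \<Longrightarrow> cmod w = cmod z \<Longrightarrow>
      f (z, w) * (1 - \<mu> * cnj (partial_w f (0, 0)) * z - \<mu> * cnj (partial_z f (0, 0)) * w)
        = partial_z f (0, 0) * z + partial_w f (0, 0) * w - \<mu> * z * w"
proof -
  define p q where "p = partial_z f (0, 0)" and "q = partial_w f (0, 0)"
  obtain \<mu> where \<mu>: "cmod \<mu> = 1" and form: "\<And>\<psi>. cmod \<psi> = 1 \<Longrightarrow>
      second_order_form f \<psi> = - \<mu> * \<psi> * of_real (1 - (cmod (p + q * \<psi>))\<^sup>2)"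
    by (rule second_order_form_extremal[folded p_def q_def]) (rule that)
  have "f (z, w) * (1 - \<mu> * cnj q * z - \<mu> * cnj p * w) = p * z + q * w - \<mu> * z * w"
    if z: "z \<in> \<D>" "z \<noteq> 0" and w: "cmod w = cmod z" for z w
  proof -
    define \<psi> where "\<psi> = w / z"
    define h where "h = slice_quotient f \<psi>"
    have \<psi>: "cmod \<psi> = 1" and w_eq: "w = z * \<psi>"
      using z w by (simp_all add: \<psi>_def norm_divide)
    have h0: "h 0 = p + q * \<psi>"
      by (simp add: h_def slice_quotient_0 p_def q_def)
    have "h z * (1 + (- \<mu> * \<psi>) * cnj (h 0) * z) = h 0 + (- \<mu> * \<psi>) * z"
      unfolding h_def
    proof (rule schwarz_pick_origin_equality[OF slice_quotient_schur[OF \<psi>]])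
      show "deriv (slice_quotient f \<psi>) 0 = (- \<mu> * \<psi>) * of_real (1 - (cmod (slice_quotient f \<psi> 0))\<^sup>2)"
        using form[OF \<psi>] by (simp add: deriv_slice_quotient slice_quotient_0 p_def q_def)
    qed (use \<mu> \<psi> z in \<open>auto simp: norm_mult\<close>)
    moreover have "f (z, w) = z * h z"
      unfolding w_eq h_def by (rule slice_eq)
    moreover have "\<psi> * cnj \<psi> = 1"
      using \<psi> by (simp flip: complex_norm_square)
    ultimately show ?thesis
      unfolding h0 w_eq by simp algebra
  qed
  with \<mu> show thesis
    using that by (simp add: p_def q_def)
qed

lemma extremal_imp_rational:
  obtains \<mu> a b where "cmod \<mu> = 1" and "cmod a + cmod b = 1"
    and "\<And>z w. z \<in> \<D> \<Longrightarrow> w \<in> \<D> \<Longrightarrow>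
      f (z, w) * (1 - cnj b * z - cnj a * w) = \<mu> * (a * z + b * w - z * w)"
proof -
  define p q where "p = partial_z f (0, 0)" and "q = partial_w f (0, 0)"
  obtain \<mu> where \<mu>: "cmod \<mu> = 1" and equal_moduli: "\<And>z w. z \<in> \<D> \<Longrightarrow> z \<noteq> 0 \<Longrightarrow> cmod w = cmod z \<Longrightarrow>
      f (z, w) * (1 - \<mu> * cnj q * z - \<mu> * cnj p * w) = p * z + q * w - \<mu> * z * w"
    by (rule extremal_rational_on_equal_moduli[folded p_def q_def]) (rule that)
  define g where "g z w = f (z, w) * (1 - \<mu> * cnj q * z - \<mu> * cnj p * w) - (p * z + q * w - \<mu> * z * w)" for z w
  have g: "g z w = 0" if "z \<in> \<D>" "w \<in> \<D>" for z w
  proof (rule zero_if_zero_on_equal_moduli[of g, OF _ _ _ that])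
    show "(\<lambda>z. g z w) holomorphic_on \<D>" if "w \<in> \<D>" for w
      unfolding g_def using that by (intro holomorphic_compose_bidisk holomorphic_intros) auto
    show "g z holomorphic_on \<D>" if "z \<in> \<D>" for z
      unfolding g_def using that by (intro holomorphic_compose_bidisk holomorphic_intros) auto
  qed (simp add: g_def equal_moduli)
  have unit: "\<mu> * cnj \<mu> = 1"
    using \<mu> by (simp flip: complex_norm_square)
  show thesis
  proof (rule that[OF \<mu>, of "cnj \<mu> * p" "cnj \<mu> * q"])
    show "cmod (cnj \<mu> * p) + cmod (cnj \<mu> * q) = 1"
      using norm_partials_origin \<mu> by (simp add: norm_mult p_def q_def)
    show "f (z, w) * (1 - cnj (cnj \<mu> * q) * z - cnj (cnj \<mu> * p) * w)
        = \<mu> * (cnj \<mu> * p * z + cnj \<mu> * q * w - z * w)" if "z \<in> \<D>" "w \<in> \<D>" for z w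
      using g[OF that] unit unfolding g_def by simp algebra
  qed
qed

end

end

section \<open>The rational functions\<close>

lemma denominator_nonzero:
  fixes a b z w :: complex
  assumes ab: "cmod a + cmod b = 1" and z: "cmod z < 1" and w: "cmod w < 1"
  shows "1 - cnj b * z - cnj a * w \<noteq> 0"
proof
  assume "1 - cnj b * z - cnj a * w = 0"
  then have "1 = cmod (cnj b * z + cnj a * w)"
    by (simp add: diff_diff_eq)
  also have "\<dots> \<le> cmod b * cmod z + cmod a * cmod w"
    by (metis norm_triangle_ineq norm_mult complex_mod_cnj)
  also have "\<dots> < 1"
  proof (cases "a = 0")
    case True
    then show ?thesis using ab z by simp
  next
    case False
    then have "cmod a * cmod w < cmod a" "cmod b * cmod z \<le> cmod b"
      using z w by (simp_all add: mult_left_le)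
    then show ?thesis using ab by linarith
  qed
  finally show False by simp
qed

lemma has_field_derivative_rational:
  fixes a b z w :: complex
  assumes ab: "cmod a + cmod b = 1" and D: "1 - cnj b * z - cnj a * w \<noteq> 0"
  shows "((\<lambda>z. (a * z + b * w - z * w) / (1 - cnj b * z - cnj a * w)) has_field_derivative
    a * (1 - cnj (cis (Arg a)) * w)\<^sup>2 / (1 - cnj b * z - cnj a * w)\<^sup>2) (at z)"
proof -
  define t \<alpha> where "t = cmod a" and "\<alpha> = cis (Arg a)"
  have \<alpha>: "\<alpha> * cnj \<alpha> = 1"
    by (simp add: \<alpha>_def flip: complex_norm_square)
  have a: "a = of_real t * \<alpha>"
    by (simp only: t_def \<alpha>_def cmod_mult_cis_Arg)
  have ca: "cnj a = of_real t * cnj \<alpha>"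
    using arg_cong[OF a, of cnj] by simp
  have "cmod b = 1 - t"
    using ab by (simp add: t_def)
  then have b: "b * cnj b = (1 - of_real t)\<^sup>2"
    by (simp flip: complex_norm_square)
  have "(a - w) * (1 - cnj b * z - cnj a * w) - (a * z + b * w - z * w) * (- cnj b)
      = a * (1 - cnj \<alpha> * w)\<^sup>2"
    using \<alpha> b unfolding ca unfolding a by algebra
  then show ?thesis
    using D unfolding \<alpha>_def by (auto intro!: derivative_eq_intros simp: power2_eq_square)
qed

lemma norm_square_denominator_diff_numerator_normalized:
  fixes u v :: complex and t :: real
  shows "(1 - (cmod u)\<^sup>2) * (t * (cmod (1 - v))\<^sup>2) + (1 - (cmod v)\<^sup>2) * ((1 - t) * (cmod (1 - u))\<^sup>2)
    = (cmod (1 - of_real (1 - t) * u - of_real t * v))\<^sup>2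
      - (cmod (of_real t * u + of_real (1 - t) * v - u * v))\<^sup>2"
  unfolding cmod_power2 by simp algebra

lemma norm_square_denominator_diff_numerator:
  fixes a b z w :: complex
  assumes ab: "cmod a + cmod b = 1"
  shows "(1 - (cmod z)\<^sup>2) * (cmod a * (cmod (1 - cnj (cis (Arg a)) * w))\<^sup>2)
      + (1 - (cmod w)\<^sup>2) * (cmod b * (cmod (1 - cnj (cis (Arg b)) * z))\<^sup>2)
    = (cmod (1 - cnj b * z - cnj a * w))\<^sup>2 - (cmod (a * z + b * w - z * w))\<^sup>2"
proof -
  define \<alpha> \<beta> t where "\<alpha> = cis (Arg a)" and "\<beta> = cis (Arg b)" and "t = cmod a"
  define u v where "u = cnj \<beta> * z" and "v = cnj \<alpha> * w"
  have bt: "cmod b = 1 - t"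
    using ab by (simp add: t_def)
  have norms: "cmod \<alpha> = 1" "cmod \<beta> = 1" "cmod u = cmod z" "cmod v = cmod w"
    by (simp_all add: u_def v_def \<alpha>_def \<beta>_def norm_mult)
  have zw: "z = \<beta> * u" "w = \<alpha> * v"
    by (simp_all add: u_def v_def \<alpha>_def \<beta>_def cis_cnj cis_mult flip: mult.assoc)
  have a: "a = of_real t * \<alpha>"
    by (simp only: t_def \<alpha>_def cmod_mult_cis_Arg)
  have b: "b = of_real (1 - t) * \<beta>"
    by (simp only: \<beta>_def cmod_mult_cis_Arg flip: bt)
  have "1 - cnj b * z - cnj a * w = 1 - of_real (1 - t) * u - of_real t * v"
    by (simp add: a b u_def v_def)
  moreover have "a * z + b * w - z * w = \<alpha> * \<beta> * (of_real t * u + of_real (1 - t) * v - u * v)"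
    unfolding zw a b by (simp add: algebra_simps)
  then have "cmod (a * z + b * w - z * w) = cmod (of_real t * u + of_real (1 - t) * v - u * v)"
    by (simp add: norm_mult norms)
  ultimately show ?thesis
    using norm_square_denominator_diff_numerator_normalized[of u t v]
    by (simp only: norms bt flip: t_def u_def v_def \<alpha>_def \<beta>_def)
qed

lemma rational_imp_extremal:
  fixes f :: "complex \<times> complex \<Rightarrow> complex"
  assumes \<mu>: "cmod \<mu> = 1" and ab: "cmod a + cmod b = 1"
    and f: "\<And>z w. z \<in> \<D> \<Longrightarrow> w \<in> \<D> \<Longrightarrow>
      f (z, w) = \<mu> * ((a * z + b * w - z * w) / (1 - cnj b * z - cnj a * w))"
  shows "everywhere_infinitesimally_extremal f"
  unfolding everywhere_infinitesimally_extremal_def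
proof clarify
  fix z w :: complex assume z: "z \<in> \<D>" and w: "w \<in> \<D>"
  define D where "D = 1 - cnj b * z - cnj a * w"
  have D: "D \<noteq> 0" "1 - cnj a * w - cnj b * z = D"
    unfolding D_def using denominator_nonzero[OF ab] z w by simp_all
  have ba: "cmod b + cmod a = 1"
    using ab by simp
  have "((\<lambda>z. f (z, w)) has_field_derivative \<mu> * (a * (1 - cnj (cis (Arg a)) * w)\<^sup>2 / D\<^sup>2)) (at z)"
    using DERIV_cmult[OF has_field_derivative_rational[OF ab D(1)[unfolded D_def]], of \<mu>] unfolding D_def
    by (rule has_field_derivative_transform_within_open[where S=\<D>]) (use z w f in auto)
  then have norm_partial_z:
    "cmod (partial_z f (z, w)) = cmod a * (cmod (1 - cnj (cis (Arg a)) * w))\<^sup>2 / (cmod D)\<^sup>2"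
    using \<mu> by (simp add: partial_z_def DERIV_imp_deriv norm_mult norm_divide norm_power)
  have "((\<lambda>w. f (z, w)) has_field_derivative \<mu> * (b * (1 - cnj (cis (Arg b)) * z)\<^sup>2 / D\<^sup>2)) (at w)"
    using DERIV_cmult[OF has_field_derivative_rational[of b a w z], of \<mu>, unfolded D(2), OF ba D(1)]
    by (rule has_field_derivative_transform_within_open[where S=\<D>])
       (use z w f in \<open>auto simp: algebra_simps\<close>)
  then have norm_partial_w:
    "cmod (partial_w f (z, w)) = cmod b * (cmod (1 - cnj (cis (Arg b)) * z))\<^sup>2 / (cmod D)\<^sup>2"
    using \<mu> by (simp add: partial_w_def DERIV_imp_deriv norm_mult norm_divide norm_power)
  have "(1 - (cmod z)\<^sup>2) * cmod (partial_z f (z, w)) + (1 - (cmod w)\<^sup>2) * cmod (partial_w f (z, w))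
     = ((cmod D)\<^sup>2 - (cmod (a * z + b * w - z * w))\<^sup>2) / (cmod D)\<^sup>2"
    unfolding norm_partial_z norm_partial_w D_def norm_square_denominator_diff_numerator[OF ab, symmetric]
    by (simp add: add_divide_distrib)
  also have "\<dots> = 1 - (cmod (f (z, w)))\<^sup>2"
    using D(1) \<mu> f[OF z w]
    by (simp add: norm_mult norm_divide power_divide diff_divide_distrib[where 'a = real] flip: D_def)
  finally show "(1 - (cmod z)\<^sup>2) * cmod (partial_z f (z, w)) + (1 - (cmod w)\<^sup>2) * cmod (partial_w f (z, w))
      = 1 - (cmod (f (z, w)))\<^sup>2" .
qed

theorem mainTheorem4:
  fixes f :: "complex \<times> complex \<Rightarrow> complex"
  assumes "f holomorphic2_on \<D>\<^sup>2"
    and "f \<in> \<D>\<^sup>2 \<rightarrow> \<D>"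
    and "f (0, 0) = 0"
  shows "everywhere_infinitesimally_extremal f \<longleftrightarrow>
    (\<exists>\<mu> a b :: complex. cmod \<mu> = 1 \<and> cmod a + cmod b = 1 \<and>
       (\<forall>(z, w) \<in> \<D>\<^sup>2. f (z, w) = \<mu> * ((a * z + b * w - z * w) / (1 - cnj b * z - cnj a * w))))"
    (is "_ \<longleftrightarrow> (\<exists>\<mu> a b. ?rational \<mu> a b)")
proof
  assume "everywhere_infinitesimally_extremal f"
  then obtain \<mu> a b where \<mu>: "cmod \<mu> = 1" and ab: "cmod a + cmod b = 1"
    and f: "\<And>z w. z \<in> \<D> \<Longrightarrow> w \<in> \<D> \<Longrightarrow>
      f (z, w) * (1 - cnj b * z - cnj a * w) = \<mu> * (a * z + b * w - z * w)"
    by (rule extremal_imp_rational[OF assms]) (rule that)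
  have "?rational \<mu> a b"
    using \<mu> ab f denominator_nonzero[OF ab] by (auto simp: eq_divide_eq)
  then show "\<exists>\<mu> a b. ?rational \<mu> a b"
    by blast
next
  assume "\<exists>\<mu> a b. ?rational \<mu> a b"
  then show "everywhere_infinitesimally_extremal f"
    using rational_imp_extremal by blast
qed

end
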